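(* Let $K$ be a nonempty compact subset of $X$ and let $F:X\to 2^Y$ be a set-valued mapping. Assume that $K$ is starshaped and that $F$ is $C$-continuous and strictly quasi $l$-$C$-convexlike on $K$ with nonempty $C$-compact values. Then the weak $l$-minimal solution set $W_l(F,K)$ is contractible. Moreover, the $l$-minimal solution set $E_l(F,K)$ is contractible.
   Context: $X$ is a (real) normed vector space, $Y$ is a (real) Banach space, and $C\subseteq Y$ is a convex, closed, pointed cone with nonempty interior $\operatorname{int}C$. For nonempty $A,B\subseteq Y$: $A\le^l B$ means $B\subseteq A+C$; $A\ll^l B$ means $B\subseteq A+\operatorname{int}C$. $E_l(F,K)$ is the set of $x_0\in K$ such that for every $x\in K$, $F(x)\le^l F(x_0)$ implies $F(x_0)\le^l F(x)$. $W_l(F,K)$ is the set of $x_0\in K$ such that for every $x\in K$, $F(x)\ll^l F(x_0)$ implies $F(x_0)\ll^l F(x)$. $F$ is strictly quasi $l$-$C$-convexlike on $K$ if for any $x_1,x_2\in K$ with $x_1\neq x_2$ there exist $x_3\in K$ and $t_0\in[0,1]$ such that $F(x_3)\ll^l t_0F(x_1)+(1-t_0)F(x_2)$. A set $A\subseteq Y$ is $C$-compact if any cover of $A$ of the form $\{U_\alpha+C: U_\alpha \text{ open}\}$ admits a finite subcover. "With nonempty $C$-compact values" means that $F(x)$ is nonempty and $C$-compact for $x\in K$. $F$ is $C$-upper semicontinuous at $u_0$ if for any neighborhood $V$ of the set $F(u_0)$ there is a neighborhood $U(u_0)$ of $u_0$ such that $F(u)\subseteq V+C$ for every $u\in U(u_0)$.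 $F$ is $C$-lower semicontinuous at $u_0$ if for any $x\in F(u_0)$ and any neighborhood $V$ of $x$ there is a neighborhood $U(u_0)$ of $u_0$ such that $F(u)\cap(V-C)\neq\emptyset$ for every $u\in U(u_0)$. $F$ is $C$-continuous on $K$ if it is both $C$-upper and $C$-lower semicontinuous at each point of $K$. $K$ is starshaped if there is $x_0\in K$ such that $\lambda x_0+(1-\lambda)y\in K$ for all $\lambda\in[0,1]$ and $y\in K$. A nonempty set $A$ in a topological space is contractible if there exist $x_0\in A$ and a continuous mapping $H:A\times[0,1]\to A$ such that $H(x,1)=x$ and $H(x,0)=x_0$ for any $x\in A$. *)

theory Defs
  imports "HOL-Analysis.Analysis"
begin

text \<open>
  Sums of sets are Minkowski sums (from \<open>HOL-Library.Set_Algebras\<close>), but \<open>V - C\<close> on sets is set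
  difference; the Minkowski difference is therefore written \<open>V + uminus ` C\<close>.
\<close>

definition pointed_cone :: "'b::real_vector set \<Rightarrow> bool" where
  "pointed_cone C \<longleftrightarrow> cone C \<and> C \<inter> uminus ` C = {0}"

definition set_le_l :: "'b::real_normed_vector set \<Rightarrow> 'b set \<Rightarrow> 'b set \<Rightarrow> bool" where
  "set_le_l C A B \<longleftrightarrow> B \<subseteq> A + C"

definition set_ll_l :: "'b::real_normed_vector set \<Rightarrow> 'b set \<Rightarrow> 'b set \<Rightarrow> bool" where
  "set_ll_l C A B \<longleftrightarrow> B \<subseteq> A + interior C"

definition E_l :: "'b::real_normed_vector set \<Rightarrow> ('a \<Rightarrow> 'b set) \<Rightarrow> 'a set \<Rightarrow> 'a set" where
  "E_l C F K = {x0 \<in> K. \<forall>x\<in>K. set_le_l C (F x) (F x0) \<longrightarrow> set_le_l C (F x0) (F x)}"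

definition W_l :: "'b::real_normed_vector set \<Rightarrow> ('a \<Rightarrow> 'b set) \<Rightarrow> 'a set \<Rightarrow> 'a set" where
  "W_l C F K = {x0 \<in> K. \<forall>x\<in>K. set_ll_l C (F x) (F x0) \<longrightarrow> set_ll_l C (F x0) (F x)}"

definition strictly_quasi_l_convexlike_on ::
    "'b::real_normed_vector set \<Rightarrow> 'a set \<Rightarrow> ('a \<Rightarrow> 'b set) \<Rightarrow> bool" where
  "strictly_quasi_l_convexlike_on C K F \<longleftrightarrow>
     (\<forall>x1\<in>K. \<forall>x2\<in>K. x1 \<noteq> x2 \<longrightarrow>
        (\<exists>x3\<in>K. \<exists>t0\<in>{0..1::real}.
           set_ll_l C (F x3) ((*\<^sub>R) t0 ` F x1 + (*\<^sub>R) (1 - t0) ` F x2)))"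

definition cone_compact :: "'b::real_normed_vector set \<Rightarrow> 'b set \<Rightarrow> bool" where
  "cone_compact C A \<longleftrightarrow>
     (\<forall>\<U>. (\<forall>U\<in>\<U>. open U) \<and> A \<subseteq> (\<Union>U\<in>\<U>. U + C) \<longrightarrow>
        (\<exists>\<V>\<subseteq>\<U>. finite \<V> \<and> A \<subseteq> (\<Union>U\<in>\<V>. U + C)))"

text \<open>
  A neighbourhood of a set \<open>S\<close> is any \<open>V\<close> with \<open>S \<subseteq> interior V\<close>. The map \<open>F\<close> is defined on the
  whole space, so neighbourhoods of \<open>u0\<close> are taken in the whole space, not relative to \<open>K\<close>.
\<close>

definition cone_usc_at ::
    "'b::real_normed_vector set \<Rightarrow> ('a::topological_space \<Rightarrow> 'b set) \<Rightarrow> 'a \<Rightarrow> bool" where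
  "cone_usc_at C F u0 \<longleftrightarrow>
     (\<forall>V. F u0 \<subseteq> interior V \<longrightarrow> (\<forall>\<^sub>F u in nhds u0. F u \<subseteq> V + C))"

definition cone_lsc_at ::
    "'b::real_normed_vector set \<Rightarrow> ('a::topological_space \<Rightarrow> 'b set) \<Rightarrow> 'a \<Rightarrow> bool" where
  "cone_lsc_at C F u0 \<longleftrightarrow>
     (\<forall>x\<in>F u0. \<forall>V. x \<in> interior V \<longrightarrow> (\<forall>\<^sub>F u in nhds u0. F u \<inter> (V + uminus ` C) \<noteq> {}))"

definition cone_continuous_on ::
    "'b::real_normed_vector set \<Rightarrow> 'a::topological_space set \<Rightarrow> ('a \<Rightarrow> 'b set) \<Rightarrow> bool" where
  "cone_continuous_on C K F \<longleftrightarrow> (\<forall>u\<in>K. cone_usc_at C F u \<and> cone_lsc_at C F u)"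

text \<open>
  The library's \<^const>\<open>contractible\<close> counts the empty set as contractible. On a nonempty set its
  constant \<open>a\<close> necessarily lies in the set.
\<close>

definition nonempty_contractible :: "'a::topological_space set \<Rightarrow> bool" where
  "nonempty_contractible A \<longleftrightarrow> A \<noteq> {} \<and> contractible A"

end

theory Submission
  imports Defs
begin

text \<open>
  Fix \<open>e\<close> in the interior of \<open>C\<close> and let \<open>g A B\<close> be the least \<open>s\<close> with \<open>B + s e \<subseteq> A + C\<close>. Strict
  quasi-convexlikeness makes the minimiser \<open>r x\<close> of \<open>z \<mapsto> g (F z) (F x)\<close> over \<open>K\<close> unique, and a
  unique minimiser of a jointly continuous function over a compact set depends continuously on the
  parameter. Every \<open>r x\<close> is weakly minimal, and \<open>r\<close> fixes the weakly minimal points, so the weakly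
  minimal points form a retract of \<open>K\<close>, which is contractible because it is starshaped. Under the
  hypotheses both solution sets consist of the points \<open>x\<close> such that no \<open>z\<close> satisfies
  \<open>F z \<lless>\<^sup>l F x\<close>, so they coincide.
\<close>

section \<open>Minkowski sums and continuity of unique minimisers\<close>

lemma mem_set_plus_iff:
  fixes A B :: "'a::ab_group_add set"
  shows "x \<in> A + B \<longleftrightarrow> (\<exists>a\<in>A. x - a \<in> B)"
proof
  assume "\<exists>a\<in>A. x - a \<in> B"
  then obtain a where "a \<in> A" "x - a \<in> B" by blast
  then have "a + (x - a) \<in> A + B" by (rule set_plus_intro)
  then show "x \<in> A + B" by simp
qed (force elim!: set_plus_elim)

lemma open_set_plus:
  fixes A B :: "'a::real_normed_vector set"
  assumes "open B"
  shows "open (A + B)"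
proof -
  have "A + B = (\<Union>a\<in>A. (+) a ` B)" by (auto simp: set_plus_def)
  then show ?thesis using assms by (auto intro: open_translation)
qed

text \<open>By uniqueness the graph of \<open>r\<close> over \<open>L\<close> is the set
  \<open>M\<close> of minimising pairs, which is closed in \<open>K \<times> L\<close> and hence
  compact. The preimage of a closed \<open>B\<close> is the projection of the part of the graph over
  \<open>B\<close>, so it is compact and therefore closed.\<close>

lemma continuous_on_unique_argmin:
  fixes g :: "'a::t2_space \<times> 'b::t2_space \<Rightarrow> real"
  assumes "compact K" "compact L" and g: "continuous_on (K \<times> L) g"
    and r: "\<And>x. x \<in> L \<Longrightarrow> r x \<in> K"
    and min: "\<And>x z. x \<in> L \<Longrightarrow> z \<in> K \<Longrightarrow> z \<noteq> r x \<Longrightarrow> g (r x, x) < g (z, x)"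
  shows "continuous_on L r"
proof -
  define M where "M = K \<times> L \<inter> (\<Inter>w\<in>K. {p \<in> K \<times> L. g p \<le> g (w, snd p)})"
  have KL: "compact (K \<times> L)" using assms by (simp add: compact_Times)
  have "closed {p \<in> K \<times> L. g p \<le> g (w, snd p)}" if "w \<in> K" for w
  proof (rule continuous_on_closed_Collect_le)
    show "continuous_on (K \<times> L) (\<lambda>p. g (w, snd p))"
      by (rule continuous_on_compose2[OF g]) (use that in \<open>auto intro!: continuous_intros\<close>)
  qed (use g KL in \<open>auto intro: compact_imp_closed\<close>)
  then have M: "compact M"
    unfolding M_def by (intro compact_Int_closed KL closed_INT) auto
  have graph: "M = {(r x, x) | x. x \<in> L}"
  proof -
    have "g (r x, x) \<le> g (w, x)" if "x \<in> L" "w \<in> K" for x w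
      using min[OF that] by (cases "w = r x") auto
    moreover have "z = r x" if "x \<in> L" "z \<in> K" "\<forall>w\<in>K. g (z, x) \<le> g (w, x)" for x z
      using min[of x z] that r[of x] by force
    ultimately show ?thesis unfolding M_def using r by auto
  qed
  have "closed (r -` B \<inter> L)" if "closed B" for B
  proof -
    have "r -` B \<inter> L = snd ` (M \<inter> B \<times> UNIV)"
      unfolding graph by force
    moreover have "compact (snd ` (M \<inter> B \<times> UNIV))"
      by (intro compact_continuous_image compact_Int_closed M closed_Times that)
        (auto intro!: continuous_intros)
    ultimately show ?thesis by (simp add: compact_imp_closed)
  qed
  then show ?thesis
    using continuous_on_closed_vimage[of L r] assms(2) compact_imp_closed by blast
qed

section \<open>Comparing sets by shifts in a fixed direction\<close>

definition shift_le :: "'b::real_normed_vector set \<Rightarrow> 'b \<Rightarrow> real \<Rightarrow> 'b set \<Rightarrow> 'b set \<Rightarrow> bool" where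
  "shift_le C e s A B \<longleftrightarrow> (\<forall>b\<in>B. b + s *\<^sub>R e \<in> A + C)"

text \<open>A Gerstewitz-type scalarisation of the lower set relation. The infimum is meaningful
  only once admissible shifts are known to exist and to be bounded below;
  \<open>shift_le_gap\<close> shows that it is then attained.\<close>

definition gap :: "'b::real_normed_vector set \<Rightarrow> 'b \<Rightarrow> 'b set \<Rightarrow> 'b set \<Rightarrow> real" where
  "gap C e A B = Inf {s. shift_le C e s A B}"

lemma shift_leE:
  assumes "shift_le C e s A B" "b \<in> B"
  obtains a where "a \<in> A" "b + s *\<^sub>R e - a \<in> C"
  using assms unfolding shift_le_def mem_set_plus_iff by blast

lemma shift_le_0_iff: "shift_le C e 0 A B \<longleftrightarrow> set_le_l C A B"
  unfolding shift_le_def set_le_l_def by auto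

text \<open>As \<open>e\<close> is interior, \<open>- e \<notin> C\<close> amounts to
  \<open>C\<close> not being the whole space. It enters through the lower bound on admissible
  shifts.\<close>

locale solid_cone =
  fixes C :: "'b::real_normed_vector set" and e :: 'b
  assumes convC: "convex C" and closedC: "closed C" and coneC: "cone C"
    and e: "e \<in> interior C" and neg_e: "- e \<notin> C"
begin

section \<open>Algebra of the cone and its interior\<close>

lemma add_C: "x \<in> C \<Longrightarrow> y \<in> C \<Longrightarrow> x + y \<in> C"
  using convex_cone[of C] convC coneC by blast

lemma scale_C: "x \<in> C \<Longrightarrow> 0 \<le> c \<Longrightarrow> c *\<^sub>R x \<in> C"
  using coneC unfolding cone_def by blast

lemma e_C: "e \<in> C"
  using e interior_subset by blast

lemma zero_C: "0 \<in> C"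
  using scale_C[OF e_C, of 0] by simp

lemma add_interior:
  assumes "x \<in> interior C" "y \<in> C"
  shows "x + y \<in> interior C"
proof -
  have "(+) y ` interior C \<subseteq> interior C"
    using assms(2) add_C interior_subset[of C]
    by (intro interior_maximal open_translation) auto
  then show ?thesis using assms(1) by (auto simp: add.commute)
qed

lemma scale_e: "0 < c \<Longrightarrow> c *\<^sub>R e \<in> interior C"
proof -
  assume c: "0 < c"
  have "(*\<^sub>R) c ` interior C \<subseteq> interior C"
    using c scale_C interior_subset[of C] by (intro interior_maximal open_scaling) auto
  then show ?thesis using e by auto
qed

text \<open>The points \<open>e + y / n\<close> tend to the interior point \<open>e\<close>, so one
  of them is interior; multiply it by \<open>n\<close>.\<close>

lemma absorb:
  "\<exists>m::nat. y + of_nat m *\<^sub>R e \<in> interior C"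
proof -
  have "(\<lambda>n. e + (1 / real (Suc n)) *\<^sub>R y) \<longlonglongrightarrow> e + 0 *\<^sub>R y"
    by (intro tendsto_intros LIMSEQ_Suc lim_1_over_n)
  then have "\<forall>\<^sub>F n in sequentially. e + (1 / real (Suc n)) *\<^sub>R y \<in> interior C"
    using e by (intro topological_tendstoD) auto
  then obtain n where n: "e + (1 / real (Suc n)) *\<^sub>R y \<in> interior C"
    using eventually_happens by force
  have "(*\<^sub>R) (real (Suc n)) ` interior C \<subseteq> interior C"
    using scale_C interior_subset[of C] by (intro interior_maximal open_scaling) auto
  then have "real (Suc n) *\<^sub>R (e + (1 / real (Suc n)) *\<^sub>R y) \<in> interior C"
    using n by blast
  then have "y + real (Suc n) *\<^sub>R e \<in> interior C"
    by (simp add: algebra_simps del: of_nat_Suc)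
  then show ?thesis by blast
qed

lemma open_absorb:
  assumes "open U" "x \<in> U"
  shows "\<exists>n::nat. x + (c / real (Suc n)) *\<^sub>R e \<in> U"
proof -
  have "(\<lambda>n. x + (c * (1 / real (Suc n))) *\<^sub>R e) \<longlonglongrightarrow> x + (c * 0) *\<^sub>R e"
    by (intro tendsto_intros LIMSEQ_Suc lim_1_over_n)
  then have "\<forall>\<^sub>F n in sequentially. x + (c * (1 / real (Suc n))) *\<^sub>R e \<in> U"
    using assms by (intro topological_tendstoD) auto
  then show ?thesis using eventually_happens by force
qed

section \<open>Upper sets and compactness relative to the cone\<close>

lemma interior_plus_C: "A + interior C + C = A + interior C"
proof
  show "A + interior C + C \<subseteq> A + interior C"
    using add_interior by (force simp: set_plus_def add.assoc)
  show "A + interior C \<subseteq> A + interior C + C"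
    using zero_C by (metis add.right_neutral set_plus_intro subsetI)
qed

text \<open>Open sets closed under adding \<open>C\<close> are admissible in the covers of
  \<open>cone_compact\<close>, and in an increasing sequence a finite subcover collapses to its
  largest member. The next three lemmas obtain their uniform bounds this way.\<close>

lemma cone_compact_nested:
  fixes V :: "nat \<Rightarrow> 'b set"
  assumes "cone_compact C A" and opn: "\<And>n. open (V n)" and up: "\<And>n. V n + C \<subseteq> V n"
    and inc: "incseq V" and sub: "A \<subseteq> (\<Union>n. V n)"
  shows "\<exists>n. A \<subseteq> V n"
proof -
  have "V n \<subseteq> V n + C" for n
    using zero_C by (metis add.right_neutral set_plus_intro subsetI)
  then have "(\<Union>n. V n) \<subseteq> (\<Union>n. V n + C)" by (intro SUP_mono) auto
  then have "A \<subseteq> (\<Union>U\<in>range V. U + C)" using sub by simp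
  then obtain \<V> where "\<V> \<subseteq> range V" "finite \<V>" and cov: "A \<subseteq> (\<Union>U\<in>\<V>. U + C)"
    using assms(1) opn unfolding cone_compact_def by (metis (no_types, lifting) imageE)
  then obtain I where I: "finite I" "\<V> = V ` I" by (meson finite_subset_image)
  have "V n + C \<subseteq> V (Max I)" if "n \<in> I" for n
    using up[of n] incseqD[OF inc Max_ge[OF I(1) that]] by blast
  \<comment> \<open>If \<open>I\<close> is empty then so is \<open>A\<close>, and the inclusion
    holds whatever \<open>Max {}\<close> is.\<close>
  then have "A \<subseteq> V (Max I)" using cov unfolding I(2) by blast
  then show ?thesis by blast
qed

text \<open>By \<open>absorb\<close>, the open upper sets \<open>y - m e + interior C\<close>
  exhaust the space.\<close>

lemma cone_compact_bounded_below:
  assumes "cone_compact C A"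
  shows "\<exists>m::nat. \<forall>a\<in>A. a + of_nat m *\<^sub>R e - y \<in> interior C"
proof -
  define V where "V = (\<lambda>m::nat. {y - of_nat m *\<^sub>R e} + interior C)"
  have V: "a \<in> V m \<longleftrightarrow> a + of_nat m *\<^sub>R e - y \<in> interior C" for a m
    unfolding V_def mem_set_plus_iff by (simp add: algebra_simps)
  have "incseq V"
  proof (rule monoI)
    fix m n :: nat assume "m \<le> n"
    show "V m \<subseteq> V n"
    proof
      fix a assume "a \<in> V m"
      then have "(a + of_nat m *\<^sub>R e - y) + (of_nat n - of_nat m) *\<^sub>R e \<in> interior C"
        unfolding V using \<open>m \<le> n\<close> by (intro add_interior scale_C e_C) auto
      then show "a \<in> V n" unfolding V by (simp add: algebra_simps)
    qed
  qed
  moreover have "A \<subseteq> (\<Union>n. V n)"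
  proof
    fix a assume "a \<in> A"
    show "a \<in> (\<Union>n. V n)"
      using absorb[of "a - y"] by (auto simp: V algebra_simps)
  qed
  ultimately have "\<exists>n. A \<subseteq> V n"
    by (intro cone_compact_nested assms)
      (auto simp: V_def interior_plus_C intro: open_set_plus)
  then show ?thesis by (auto simp: V subset_eq)
qed

text \<open>Each point of \<open>A\<close> stays in the open set \<open>B + interior C\<close> after
  a small step along \<open>- e\<close>. Compactness makes the step length uniform, which turns the
  strict relation into a negative shift.\<close>

lemma cone_compact_interior_margin:
  assumes "cone_compact C A" "A \<subseteq> B + interior C"
  shows "\<exists>\<epsilon>>0. shift_le C e (- \<epsilon>) B A"
proof -
  define V where "V = (\<lambda>n::nat. (\<lambda>b. b + (1 / real (Suc n)) *\<^sub>R e) ` B + interior C)"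
  have V: "a \<in> V n \<longleftrightarrow> a - (1 / real (Suc n)) *\<^sub>R e \<in> B + interior C" for a n
    unfolding V_def mem_set_plus_iff by (simp add: algebra_simps del: of_nat_Suc)
  have "incseq V"
  proof (rule monoI)
    fix m n :: nat assume "m \<le> n"
    show "V m \<subseteq> V n"
    proof
      fix a assume "a \<in> V m"
      then obtain b where b: "b \<in> B" "a - (1 / real (Suc m)) *\<^sub>R e - b \<in> interior C"
        unfolding V mem_set_plus_iff by blast
      have "(a - (1 / real (Suc m)) *\<^sub>R e - b) + (1 / real (Suc m) - 1 / real (Suc n)) *\<^sub>R e
          \<in> interior C"
        using \<open>m \<le> n\<close> by (intro add_interior b scale_C e_C) (simp add: frac_le)
      then show "a \<in> V n" unfolding V mem_set_plus_iff
        using b(1) by (auto simp: algebra_simps simp del: of_nat_Suc intro!: bexI[of _ b])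
    qed
  qed
  moreover have "A \<subseteq> (\<Union>n. V n)"
  proof
    fix a assume "a \<in> A"
    then have "\<exists>n. a + (- 1 / real (Suc n)) *\<^sub>R e \<in> B + interior C"
      using assms(2) by (intro open_absorb open_set_plus) auto
    then show "a \<in> (\<Union>n. V n)" by (auto simp: V)
  qed
  ultimately have "\<exists>n. A \<subseteq> V n"
    by (intro cone_compact_nested assms)
      (auto simp: V_def interior_plus_C intro: open_set_plus)
  then obtain n where "A \<subseteq> V n" by blast
  then have "shift_le C e (- (1 / real (Suc n))) B A"
    unfolding shift_le_def subset_eq V
    using interior_subset[of C] set_plus_mono2[of B B "interior C" C] by auto
  then show ?thesis by (intro exI[of _ "1 / real (Suc n)"]) auto
qed

text \<open>Let \<open>b\<close> lie outside \<open>A + C\<close>. As \<open>C\<close> is closed,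
  each \<open>a\<close> in \<open>A\<close> admits an \<open>n\<close> with \<open>b + e / n\<close>
  outside \<open>a + C\<close>; compactness gives one \<open>n\<close> for all of \<open>A\<close>.
  Then \<open>b + e / n - interior C\<close> is an open set around \<open>b\<close> that misses
  \<open>A + C\<close>.\<close>

lemma cone_compact_closed_plus:
  assumes "cone_compact C A"
  shows "closed (A + C)"
proof -
  have "\<exists>T. open T \<and> b \<in> T \<and> T \<subseteq> - (A + C)" if b: "b \<notin> A + C" for b
  proof -
    define V where "V = (\<lambda>n::nat. {a. b + (1 / real (Suc n)) *\<^sub>R e - a \<notin> C})"
    have opn: "open (V n)" for n
    proof -
      have "V n = (\<lambda>a. b + (1 / real (Suc n)) *\<^sub>R e - a) -` (- C)"
        unfolding V_def by auto
      then show ?thesis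
        using closedC by (auto intro!: open_vimage continuous_intros simp del: of_nat_Suc)
    qed
    have up: "V n + C \<subseteq> V n" for n
    proof
      fix x assume "x \<in> V n + C"
      then obtain a where a: "a \<in> V n" "x - a \<in> C" unfolding mem_set_plus_iff by blast
      show "x \<in> V n"
      proof (rule ccontr)
        assume "x \<notin> V n"
        then have "(b + (1 / real (Suc n)) *\<^sub>R e - x) + (x - a) \<in> C"
          using a unfolding V_def by (intro add_C) auto
        then show False using a(1) unfolding V_def by (simp add: algebra_simps)
      qed
    qed
    have inc: "incseq V"
    proof (rule monoI)
      fix m n :: nat assume "m \<le> n"
      show "V m \<subseteq> V n"
      proof
        fix a assume a: "a \<in> V m"
        show "a \<in> V n"
        proof (rule ccontr)
          assume "a \<notin> V n"
          then have "(b + (1 / real (Suc n)) *\<^sub>R e - a) + (1 / real (Suc m) - 1 / real (Suc n)) *\<^sub>R e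
              \<in> C"
            using \<open>m \<le> n\<close> unfolding V_def by (intro add_C scale_C e_C) (auto simp: frac_le)
          then show False using a unfolding V_def by (simp add: algebra_simps)
        qed
      qed
    qed
    have "A \<subseteq> (\<Union>n. V n)"
    proof
      fix a assume "a \<in> A"
      then have "b - a \<in> - C" using b unfolding mem_set_plus_iff by blast
      then have "\<exists>n. (b - a) + (1 / real (Suc n)) *\<^sub>R e \<in> - C"
        using closedC by (intro open_absorb) auto
      then show "a \<in> (\<Union>n. V n)" unfolding V_def by (auto simp: algebra_simps)
    qed
    then obtain n where n: "A \<subseteq> V n"
      using cone_compact_nested[OF assms opn up inc] by blast
    define T where "T = (\<lambda>y. b + (1 / real (Suc n)) *\<^sub>R e - y) -` interior C"
    have "open T"
      unfolding T_def by (intro open_vimage) (auto intro!: continuous_intros simp del: of_nat_Suc)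
    moreover have "b \<in> T"
      unfolding T_def using scale_e[of "1 / real (Suc n)"] by auto
    moreover have "T \<subseteq> - (A + C)"
    proof (clarify)
      fix y assume y: "y \<in> T" "y \<in> A + C"
      then obtain a where a: "a \<in> A" "y - a \<in> C" unfolding mem_set_plus_iff by blast
      have "(b + (1 / real (Suc n)) *\<^sub>R e - y) + (y - a) \<in> C"
        using y a interior_subset[of C] unfolding T_def by (intro add_C) auto
      then show False using a n unfolding V_def by (auto simp: algebra_simps)
    qed
    ultimately show ?thesis by blast
  qed
  then have "open (- (A + C))" by (subst open_subopen) auto
  then show ?thesis by (simp add: closed_def)
qed

section \<open>Composition of shifts and attainment of the gap\<close>

lemma shift_le_trans:
  assumes "shift_le C e s A B" "shift_le C e t B D"
  shows "shift_le C e (s + t) A D"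
  unfolding shift_le_def mem_set_plus_iff
proof
  fix d assume "d \<in> D"
  then obtain b where b: "b \<in> B" "d + t *\<^sub>R e - b \<in> C" using assms(2) by (elim shift_leE)
  then obtain a where a: "a \<in> A" "b + s *\<^sub>R e - a \<in> C" using assms(1) by (elim shift_leE)
  have "(d + t *\<^sub>R e - b) + (b + s *\<^sub>R e - a) \<in> C" using a b by (intro add_C)
  then show "\<exists>a\<in>A. d + (s + t) *\<^sub>R e - a \<in> C"
    using a(1) by (auto simp: algebra_simps intro!: bexI[of _ a])
qed

lemma set_le_ll_trans:
  assumes "set_ll_l C A B" "set_le_l C B D"
  shows "set_ll_l C A D"
proof -
  have "D \<subseteq> (A + interior C) + C"
    using assms set_plus_mono2[of B "A + interior C" C C]
    unfolding set_ll_l_def set_le_l_def by auto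
  then show ?thesis unfolding interior_plus_C set_ll_l_def .
qed

lemma set_ll_imp_le: "set_ll_l C A B \<Longrightarrow> set_le_l C A B"
  using interior_subset[of C] set_plus_mono2[of A A "interior C" C]
  unfolding set_ll_l_def set_le_l_def by auto

lemma set_le_refl: "set_le_l C A A"
  unfolding set_le_l_def mem_set_plus_iff subset_eq using zero_C by force

text \<open>A single point of \<open>A\<close> suffices, because \<open>B\<close> is bounded below
  in direction \<open>e\<close>.\<close>

lemma shift_le_nonempty:
  assumes "cone_compact C B" "A \<noteq> {}"
  shows "\<exists>s. shift_le C e s A B"
proof -
  obtain a where a: "a \<in> A" using assms by blast
  obtain m :: nat where "\<forall>b\<in>B. b + of_nat m *\<^sub>R e - a \<in> interior C"
    using cone_compact_bounded_below[OF assms(1)] by blast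
  then have "shift_le C e (of_nat m) A B"
    unfolding shift_le_def mem_set_plus_iff using a interior_subset[of C] by blast
  then show ?thesis by blast
qed

text \<open>Fix \<open>b\<close> in \<open>B\<close> and choose \<open>m\<close> with
  \<open>A\<close> above \<open>b - m e\<close>. An admissible \<open>s\<close> puts
  \<open>b + s e\<close> above some point of \<open>A\<close>, so \<open>(s + m) e\<close> lies in
  \<open>C\<close>; for \<open>s < - m\<close> rescaling would give
  \<open>- e \<in> C\<close>.\<close>

lemma shift_le_bdd_below:
  assumes "cone_compact C A" "B \<noteq> {}"
  shows "bdd_below {s. shift_le C e s A B}"
proof -
  obtain b where b: "b \<in> B" using assms by blast
  obtain m :: nat where m: "\<forall>a\<in>A. a + of_nat m *\<^sub>R e - b \<in> interior C"
    using cone_compact_bounded_below[OF assms(1)] by blast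
  have "- of_nat m \<le> s" if s: "shift_le C e s A B" for s
  proof (rule ccontr)
    assume neg: "\<not> - of_nat m \<le> s"
    obtain a where a: "a \<in> A" "b + s *\<^sub>R e - a \<in> C" using shift_leE[OF s b] .
    have "(b + s *\<^sub>R e - a) + (a + of_nat m *\<^sub>R e - b) \<in> C"
      using a m interior_subset[of C] by (intro add_C[OF a(2)]) auto
    then have "(s + of_nat m) *\<^sub>R e \<in> C" by (simp add: algebra_simps)
    from scale_C[OF this, of "1 / (- s - of_nat m)"] have "(1 / (- s - of_nat m)) *\<^sub>R ((s + of_nat m) *\<^sub>R e) \<in> C"
      using neg by simp
    moreover have "(1 / (- s - of_nat m)) * (s + of_nat m) = -1"
      using neg by (simp add: field_simps)
    ultimately show False using neg_e unfolding scaleR_scaleR by simp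
  qed
  then show ?thesis by (intro bdd_belowI) auto
qed

lemma gap_le:
  assumes "cone_compact C A" "B \<noteq> {}" "shift_le C e s A B"
  shows "gap C e A B \<le> s"
  unfolding gap_def using assms shift_le_bdd_below by (intro cInf_lower) auto

text \<open>For each \<open>b\<close> the admissible shifts are the preimage of the closed set
  \<open>A + C\<close> under an affine map of the line, so the set of admissible shifts is closed
  and contains its infimum.\<close>

lemma shift_le_gap:
  assumes "cone_compact C A" "cone_compact C B" "A \<noteq> {}" "B \<noteq> {}"
  shows "shift_le C e (gap C e A B) A B"
proof -
  have "{s. shift_le C e s A B} = (\<Inter>b\<in>B. (\<lambda>s. b + s *\<^sub>R e) -` (A + C))"
    unfolding shift_le_def by auto
  moreover have "closed \<dots>"
    using assms by (intro closed_INT ballI closed_vimage cone_compact_closed_plus)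
      (auto intro!: continuous_intros)
  ultimately have "closed {s. shift_le C e s A B}" by simp
  then have "Inf {s. shift_le C e s A B} \<in> {s. shift_le C e s A B}"
    using shift_le_nonempty[OF assms(2,3)] shift_le_bdd_below[OF assms(1,4)]
    by (intro closed_contains_Inf) auto
  then show ?thesis unfolding gap_def by simp
qed

text \<open>Perturbing the two arguments costs at most the shifts that relate them to the old ones;
  this is the source of continuity of the gap.\<close>

lemma gap_triangle:
  assumes "cone_compact C A" "cone_compact C B" "A \<noteq> {}" "B \<noteq> {}"
    and "cone_compact C A'" "B' \<noteq> {}"
    and "shift_le C e s A' A" "shift_le C e t B B'"
  shows "gap C e A' B' \<le> s + gap C e A B + t"
  using assms shift_le_trans[OF shift_le_trans[OF assms(7) shift_le_gap] assms(8)]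
  by (intro gap_le) auto

text \<open>A uniform margin would compose with the least admissible shift of \<open>A\<close>
  against itself and make it smaller.\<close>

lemma not_set_ll_refl:
  assumes "cone_compact C A" "A \<noteq> {}"
  shows "\<not> set_ll_l C A A"
proof
  assume "set_ll_l C A A"
  then obtain \<epsilon> where \<epsilon>: "\<epsilon> > 0" "shift_le C e (- \<epsilon>) A A"
    using assms cone_compact_interior_margin unfolding set_ll_l_def by blast
  have "gap C e A A \<le> - \<epsilon> + gap C e A A"
    using assms \<epsilon> shift_le_trans[OF \<epsilon>(2) shift_le_gap] by (intro gap_le) auto
  then show False using \<epsilon> by simp
qed

section \<open>Semicontinuity expressed by small shifts\<close>

lemma usc_shift_le:
  assumes "cone_usc_at C F u" "\<epsilon> > 0"
  shows "\<forall>\<^sub>F v in nhds u. shift_le C e \<epsilon> (F u) (F v)"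
proof -
  \<comment> \<open>An open neighbourhood of \<open>F u\<close> with \<open>V + C = V\<close>, so
    that upper semicontinuity yields \<open>F v \<subseteq> V\<close> itself.\<close>
  define V where "V = (\<lambda>y. y - \<epsilon> *\<^sub>R e) ` F u + interior C"
  have V: "y \<in> V \<longleftrightarrow> y + \<epsilon> *\<^sub>R e \<in> F u + interior C" for y
    unfolding V_def mem_set_plus_iff by (auto simp: algebra_simps)
  have "F u \<subseteq> interior V"
    using scale_e[OF assms(2)] unfolding V_def
    by (subst interior_open) (auto simp: open_set_plus V[unfolded V_def] set_plus_intro)
  then have "\<forall>\<^sub>F v in nhds u. F v \<subseteq> V + C" using assms(1) unfolding cone_usc_at_def by blast
  then show ?thesis
  proof eventually_elim
    case (elim v)
    then have "F v \<subseteq> V" unfolding V_def interior_plus_C .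
    then show ?case
      using set_plus_mono2[of "F u" "F u" "interior C" C] interior_subset[of C]
      by (auto simp: V subset_eq shift_le_def)
  qed
qed

text \<open>Lower semicontinuity acts at one point at a time, and compactness reduces
  \<open>F u\<close> to finitely many points. Half of \<open>\<epsilon>\<close> leads from any
  \<open>x\<close> in \<open>F u\<close> up to above a chosen \<open>y\<close>, the other half from
  \<open>y\<close> up to above a point of \<open>F v\<close>. The neighbourhood of \<open>y\<close>
  is \<open>y + (\<epsilon>/2) e - interior C\<close>, so that all points of its Minkowski
  difference with \<open>C\<close> lie below \<open>y + (\<epsilon>/2) e\<close>.\<close>

lemma lsc_shift_le:
  assumes "cone_lsc_at C F u" "cone_compact C (F u)" "\<epsilon> > 0"
  shows "\<forall>\<^sub>F v in nhds u. shift_le C e \<epsilon> (F v) (F u)"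
proof -
  define U where "U = (\<lambda>y. {y - (\<epsilon>/2) *\<^sub>R e} + interior C)"
  have "F u \<subseteq> (\<Union>V\<in>U ` F u. V + C)"
  proof
    fix y assume "y \<in> F u"
    moreover have "y \<in> U y + C"
      unfolding U_def interior_plus_C using scale_e[of "\<epsilon>/2"] assms(3)
      by (simp add: mem_set_plus_iff)
    ultimately show "y \<in> (\<Union>V\<in>U ` F u. V + C)" by blast
  qed
  then obtain \<V> where "\<V> \<subseteq> U ` F u" "finite \<V>" "F u \<subseteq> (\<Union>V\<in>\<V>. V + C)"
    using assms(2)[unfolded cone_compact_def, rule_format, of "U ` F u"]
    by (auto simp: U_def open_set_plus)
  then obtain I where I: "I \<subseteq> F u" "finite I" "F u \<subseteq> (\<Union>y\<in>I. U y + C)"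
    using finite_subset_image[of \<V> U "F u"] by auto
  have "\<forall>\<^sub>F v in nhds u. F v \<inter> ((\<lambda>z. y + (\<epsilon>/2) *\<^sub>R e - z) ` interior C + uminus ` C) \<noteq> {}"
    if y: "y \<in> I" for y
  proof -
    let ?V = "(\<lambda>z. y + (\<epsilon>/2) *\<^sub>R e - z) ` interior C"
    have "?V = (\<lambda>z. y + (\<epsilon>/2) *\<^sub>R e - z) -` interior C"
      by (force simp: image_iff)
    then have "open ?V" by (auto intro!: open_vimage continuous_intros)
    moreover have "y \<in> ?V"
      using scale_e[of "\<epsilon>/2"] assms(3) by (auto simp: image_iff intro!: bexI)
    ultimately have "y \<in> interior ?V" by (simp add: interior_open)
    then show ?thesis
      using assms(1) y I(1) unfolding cone_lsc_at_def by blast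
  qed
  then have "\<forall>\<^sub>F v in nhds u. \<forall>y\<in>I.
      F v \<inter> ((\<lambda>z. y + (\<epsilon>/2) *\<^sub>R e - z) ` interior C + uminus ` C) \<noteq> {}"
    using I(2) by (simp add: eventually_ball_finite)
  then show ?thesis
  proof eventually_elim
    case (elim v)
    show ?case unfolding shift_le_def mem_set_plus_iff
    proof
      fix x assume "x \<in> F u"
      then obtain y where y: "y \<in> I" "x \<in> U y + C" using I(3) by blast
      then have xy: "x - y + (\<epsilon>/2) *\<^sub>R e \<in> C"
        using interior_subset[of C] unfolding U_def interior_plus_C
        by (auto simp: mem_set_plus_iff algebra_simps)
      obtain w z c where w: "w \<in> F v" "z \<in> interior C" "c \<in> C"
          "w = y + (\<epsilon>/2) *\<^sub>R e - z + - c"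
        using elim y(1) unfolding set_plus_def by blast
      have "(x - y + (\<epsilon>/2) *\<^sub>R e) + (z + c) \<in> C"
        using xy w interior_subset[of C] by (auto intro: add_C[OF xy add_C])
      moreover have "(\<epsilon>/2) *\<^sub>R e + (\<epsilon>/2) *\<^sub>R e = \<epsilon> *\<^sub>R e"
        by (simp flip: scaleR_left.add)
      then have "\<epsilon> *\<^sub>R e = (\<epsilon>/2) *\<^sub>R e + (\<epsilon>/2) *\<^sub>R e" ..
      then have "(x - y + (\<epsilon>/2) *\<^sub>R e) + (z + c) = x + \<epsilon> *\<^sub>R e - w"
        unfolding w(4) by simp
      ultimately show "\<exists>w\<in>F v. x + \<epsilon> *\<^sub>R e - w \<in> C" using w(1) by auto
    qed
  qed
qed

lemma continuous_on_gap:
  assumes cont: "cone_continuous_on C K F"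
    and F: "\<And>x. x \<in> K \<Longrightarrow> F x \<noteq> {} \<and> cone_compact C (F x)"
  shows "continuous_on (K \<times> K) (\<lambda>(z, x). gap C e (F z) (F x))"
proof -
  have near: "\<forall>\<^sub>F v in nhds u. shift_le C e \<epsilon> (F u) (F v) \<and> shift_le C e \<epsilon> (F v) (F u)"
    if "u \<in> K" "\<epsilon> > 0" for u \<epsilon>
    using cont that F unfolding cone_continuous_on_def
    by (intro eventually_conj usc_shift_le lsc_shift_le) auto
  have "((\<lambda>(z, x). gap C e (F z) (F x)) \<longlongrightarrow> gap C e (F z) (F x)) (at (z, x) within K \<times> K)"
    if zx: "z \<in> K" "x \<in> K" for z x
  proof (rule tendstoI)
    fix \<epsilon> :: real assume "\<epsilon> > 0"
    then have \<epsilon>: "\<epsilon> / 3 > 0" by simp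
    have "\<forall>\<^sub>F p in nhds z \<times>\<^sub>F nhds x.
        (shift_le C e (\<epsilon>/3) (F z) (F (fst p)) \<and> shift_le C e (\<epsilon>/3) (F (fst p)) (F z)) \<and>
        (shift_le C e (\<epsilon>/3) (F x) (F (snd p)) \<and> shift_le C e (\<epsilon>/3) (F (snd p)) (F x))"
      using eventually_prodI[OF near[OF zx(1) \<epsilon>] near[OF zx(2) \<epsilon>]] .
    \<comment> \<open>The shifts are available in a full neighbourhood, but the gap estimates need
      nonempty \<open>C\<close>-compact values, which are guaranteed only on
      \<open>K\<close>.\<close>
    then have "\<forall>\<^sub>F p in at (z, x) within K \<times> K. p \<in> K \<times> K \<longrightarrow>
        (shift_le C e (\<epsilon>/3) (F z) (F (fst p)) \<and> shift_le C e (\<epsilon>/3) (F (fst p)) (F z)) \<and>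
        (shift_le C e (\<epsilon>/3) (F x) (F (snd p)) \<and> shift_le C e (\<epsilon>/3) (F (snd p)) (F x))"
      unfolding nhds_prod[symmetric] eventually_at_filter by eventually_elim auto
    moreover have "\<forall>\<^sub>F p in at (z, x) within K \<times> K. p \<in> K \<times> K"
      by (simp add: eventually_at_filter)
    ultimately show "\<forall>\<^sub>F p in at (z, x) within K \<times> K.
        dist (case p of (z, x) \<Rightarrow> gap C e (F z) (F x)) (gap C e (F z) (F x)) < \<epsilon>"
    proof eventually_elim
      case (elim p)
      obtain z' x' where p: "p = (z', x')" by (cases p)
      have K: "z' \<in> K" "x' \<in> K" using elim p by auto
      \<comment> \<open>One third of \<open>\<epsilon>\<close> pays for each argument, so the two
        gaps differ by at most \<open>2 * \<epsilon> / 3\<close>.\<close>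
      have "gap C e (F z') (F x') \<le> \<epsilon>/3 + gap C e (F z) (F x) + \<epsilon>/3"
        using elim F K zx unfolding p by (intro gap_triangle) auto
      moreover have "gap C e (F z) (F x) \<le> \<epsilon>/3 + gap C e (F z') (F x') + \<epsilon>/3"
        using elim F K zx unfolding p by (intro gap_triangle) auto
      ultimately show ?case unfolding p using \<open>\<epsilon> > 0\<close> by (simp add: dist_real_def)
    qed
  qed
  then show ?thesis unfolding continuous_on_def by auto
qed

section \<open>Convexlikeness and improvement of shifts\<close>

lemma shift_le_convex_comb:
  assumes "shift_le C e s A D" "shift_le C e s B D" "t \<in> {0..1}"
  shows "shift_le C e s ((*\<^sub>R) t ` A + (*\<^sub>R) (1 - t) ` B) D"
  unfolding shift_le_def mem_set_plus_iff
proof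
  fix d assume d: "d \<in> D"
  obtain a where a: "a \<in> A" "d + s *\<^sub>R e - a \<in> C" using shift_leE[OF assms(1) d] .
  obtain b where b: "b \<in> B" "d + s *\<^sub>R e - b \<in> C" using shift_leE[OF assms(2) d] .
  have "t *\<^sub>R (d + s *\<^sub>R e - a) + (1 - t) *\<^sub>R (d + s *\<^sub>R e - b) \<in> C"
    using a b assms(3) by (intro add_C scale_C) auto
  moreover have "t *\<^sub>R (d + s *\<^sub>R e - a) + (1 - t) *\<^sub>R (d + s *\<^sub>R e - b)
      = d + s *\<^sub>R e - (t *\<^sub>R a + (1 - t) *\<^sub>R b)"
    by (simp add: algebra_simps)
  ultimately show "\<exists>y\<in>(*\<^sub>R) t ` A + (*\<^sub>R) (1 - t) ` B. d + s *\<^sub>R e - y \<in> C"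
    using a(1) b(1) by (metis image_eqI set_plus_intro)
qed

text \<open>Two different points sharing a shift \<open>s\<close> can be beaten: the convex
  combination of their values also admits \<open>s\<close>, and \<open>x3\<close> dominates that
  combination strictly. This excludes two minimisers of the gap.\<close>

lemma convexlike_improve:
  assumes "strictly_quasi_l_convexlike_on C K F"
    and "x1 \<in> K" "x2 \<in> K" "x1 \<noteq> x2" and D: "cone_compact C D"
    and le: "shift_le C e s (F x1) D" "shift_le C e s (F x2) D"
  obtains x3 \<epsilon> where "x3 \<in> K" "\<epsilon> > 0" "shift_le C e (s - \<epsilon>) (F x3) D"
proof -
  obtain x3 t where x3: "x3 \<in> K" "t \<in> {0..1}"
    and ll: "set_ll_l C (F x3) ((*\<^sub>R) t ` F x1 + (*\<^sub>R) (1 - t) ` F x2)"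
    using assms(1-4) unfolding strictly_quasi_l_convexlike_on_def by blast
  \<comment> \<open>Moving the shift onto \<open>F x3\<close> lets the margin lemma be applied to
    \<open>D\<close> itself, whose \<open>C\<close>-compactness is given.\<close>
  define E where "E = (\<lambda>y. y - s *\<^sub>R e) ` F x3"
  have "D \<subseteq> E + interior C"
  proof
    fix d assume d: "d \<in> D"
    have "(\<lambda>d. d + s *\<^sub>R e) ` D \<subseteq> (*\<^sub>R) t ` F x1 + (*\<^sub>R) (1 - t) ` F x2 + C"
      using shift_le_convex_comb[OF le x3(2)] unfolding shift_le_def by auto
    then have "set_ll_l C (F x3) ((\<lambda>d. d + s *\<^sub>R e) ` D)"
      using set_le_ll_trans[OF ll] unfolding set_le_l_def by blast
    then have "d + s *\<^sub>R e \<in> F x3 + interior C" using d unfolding set_ll_l_def by blast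
    then show "d \<in> E + interior C"
      unfolding E_def mem_set_plus_iff by (auto simp: algebra_simps)
  qed
  then obtain \<epsilon> where \<epsilon>: "\<epsilon> > 0" "shift_le C e (- \<epsilon>) E D"
    using cone_compact_interior_margin[OF D] by blast
  have "shift_le C e (s - \<epsilon>) (F x3) D"
    using \<epsilon>(2) unfolding shift_le_def E_def mem_set_plus_iff by (auto simp: algebra_simps)
  then show ?thesis using that x3(1) \<epsilon>(1) by blast
qed

section \<open>The retraction onto the solution set\<close>

theorem nonempty_contractible_solutions:
  fixes K :: "'a::real_normed_vector set"
  assumes "K \<noteq> {}" and K: "compact K" and "starlike K"
    and cont: "cone_continuous_on C K F"
    and conv: "strictly_quasi_l_convexlike_on C K F"
    and F: "\<And>x. x \<in> K \<Longrightarrow> F x \<noteq> {} \<and> cone_compact C (F x)"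
  shows "nonempty_contractible (W_l C F K) \<and> nonempty_contractible (E_l C F K)"
proof -
  define g where "g = (\<lambda>(z, x). gap C e (F z) (F x))"
  define W where "W = {x \<in> K. \<forall>z\<in>K. \<not> set_ll_l C (F z) (F x)}"
  have cont_g: "continuous_on (K \<times> K) g"
    unfolding g_def using continuous_on_gap[OF cont F] by simp
  \<comment> \<open>For \<open>z \<noteq> x\<close> convexlikeness gives a \<open>y\<close> strictly
    dominating a combination of \<open>F z\<close> and \<open>F x\<close>. That combination
    dominates \<open>F x\<close>, so \<open>y\<close> would contradict
    \<open>x \<in> W\<close>.\<close>
  have W_strict: "z = x" if "x \<in> W" "z \<in> K" "set_le_l C (F z) (F x)" for x z
  proof (rule ccontr)
    assume "z \<noteq> x"
    moreover have "x \<in> K" using that(1) unfolding W_def by blast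
    moreover note \<open>z \<in> K\<close>
    ultimately obtain y t where "y \<in> K" "t \<in> {0..1}"
      and ll: "set_ll_l C (F y) ((*\<^sub>R) t ` F z + (*\<^sub>R) (1 - t) ` F x)"
      using conv unfolding strictly_quasi_l_convexlike_on_def by blast
    moreover have "set_le_l C ((*\<^sub>R) t ` F z + (*\<^sub>R) (1 - t) ` F x) (F x)"
      using shift_le_convex_comb[of 0 "F z" "F x" "F x" t] \<open>t \<in> {0..1}\<close> that(3) set_le_refl
      by (simp add: shift_le_0_iff)
    ultimately have "set_ll_l C (F y) (F x)" using set_le_ll_trans by blast
    then show False using that(1) \<open>y \<in> K\<close> unfolding W_def by blast
  qed
  have irrefl: "\<not> set_ll_l C (F x) (F x)" if "x \<in> K" for x
    using not_set_ll_refl F[OF that] by blast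
  \<comment> \<open>If \<open>F z\<close> strictly dominates \<open>F x\<close> and minimality
    reverses the relation, transitivity makes \<open>F z\<close> strictly dominate itself. The same
    argument gives the first inclusion for \<open>E_l\<close>.\<close>
  have WW: "W_l C F K = W"
    unfolding W_l_def W_def using irrefl set_le_ll_trans set_ll_imp_le by blast
  have EW: "E_l C F K = W"
  proof
    show "E_l C F K \<subseteq> W"
      unfolding E_l_def W_def using irrefl set_le_ll_trans set_ll_imp_le by blast
    \<comment> \<open>A competitor of a point of \<open>W\<close> equals that point by
      \<open>W_strict\<close>, so the reverse relation is reflexivity.\<close>
    show "W \<subseteq> E_l C F K"
      using W_strict set_le_refl unfolding E_l_def by (auto simp: W_def)
  qed
  have improve: "\<exists>y\<in>K. g (y, x) < s"
    if "x \<in> K" "z \<in> K" "w \<in> K" "z \<noteq> w" "g (z, x) = s" "g (w, x) = s" for x z w s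
  proof -
    have "shift_le C e s (F z) (F x)" "shift_le C e s (F w) (F x)"
      using shift_le_gap[of "F z" "F x"] shift_le_gap[of "F w" "F x"] that F
      unfolding g_def by auto
    from convexlike_improve[OF conv that(2-4) _ this]
    obtain y \<epsilon> where "y \<in> K" "\<epsilon> > 0" "shift_le C e (s - \<epsilon>) (F y) (F x)"
      using F \<open>x \<in> K\<close> by blast
    then have "g (y, x) \<le> s - \<epsilon>" unfolding g_def using F that(1) gap_le by simp
    then show ?thesis using \<open>\<epsilon> > 0\<close> \<open>y \<in> K\<close> by force
  qed
  have "\<exists>r. r \<in> K \<and> (\<forall>z\<in>K. z \<noteq> r \<longrightarrow> g (r, x) < g (z, x))" if x: "x \<in> K" for x
  proof -
    have "continuous_on K (\<lambda>z. g (z, x))"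
      by (rule continuous_on_compose2[OF cont_g]) (use x in \<open>auto intro!: continuous_intros\<close>)
    then obtain r where r: "r \<in> K" "\<forall>z\<in>K. g (r, x) \<le> g (z, x)"
      using continuous_attains_inf[OF K \<open>K \<noteq> {}\<close>] by blast
    have "g (r, x) < g (z, x)" if "z \<in> K" "z \<noteq> r" for z
      using improve[OF x that(1) r(1) that(2)] r that(1) by (metis leD le_less)
    then show ?thesis using r(1) by blast
  qed
  then obtain r where r: "\<And>x. x \<in> K \<Longrightarrow> r x \<in> K"
    and min: "\<And>x z. x \<in> K \<Longrightarrow> z \<in> K \<Longrightarrow> z \<noteq> r x \<Longrightarrow> g (r x, x) < g (z, x)"
    by metis
  have cont_r: "continuous_on K r"
    using continuous_on_unique_argmin[OF K K cont_g r min] .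
  \<comment> \<open>A \<open>z\<close> strictly dominating \<open>r x\<close> does so with a margin
    \<open>\<epsilon>\<close>, and would lower the minimal gap to \<open>F x\<close> by
    \<open>\<epsilon>\<close>.\<close>
  have r_W: "r x \<in> W" if x: "x \<in> K" for x
  proof -
    have False if z: "z \<in> K" "set_ll_l C (F z) (F (r x))" for z
    proof -
      obtain \<epsilon> where \<epsilon>: "\<epsilon> > 0" "shift_le C e (- \<epsilon>) (F z) (F (r x))"
        using z(2) cone_compact_interior_margin F r[OF x] unfolding set_ll_l_def by blast
      have "shift_le C e (- \<epsilon> + g (r x, x)) (F z) (F x)"
        unfolding g_def prod.case using F x r[OF x]
        by (intro shift_le_trans[OF \<epsilon>(2)] shift_le_gap) auto
      then have "g (z, x) \<le> - \<epsilon> + g (r x, x)" unfolding g_def using gap_le F x z by simp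
      then show False using min[OF x z(1)] \<epsilon>(1) by (cases "z = r x") auto
    qed
    then show ?thesis unfolding W_def using r[OF x] by blast
  qed
  \<comment> \<open>The shift \<open>0\<close> is admissible for \<open>F x\<close> against itself,
    so a minimiser other than \<open>x\<close> has negative gap. A negative admissible shift makes
    \<open>0\<close> admissible too, hence \<open>F (r x)\<close> dominates \<open>F x\<close>,
    against \<open>W_strict\<close>.\<close>
  have r_id: "r x = x" if xW: "x \<in> W" for x
  proof (rule ccontr)
    assume neq: "r x \<noteq> x"
    have x: "x \<in> K" using xW unfolding W_def by blast
    have "g (x, x) \<le> 0"
      unfolding g_def using gap_le F[OF x] set_le_refl by (simp add: shift_le_0_iff)
    then have neg: "g (r x, x) < 0" using min[OF x x] neq by auto
    have le: "shift_le C e (g (r x, x)) (F (r x)) (F x)"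
      unfolding g_def using shift_le_gap F x r by simp
    have "shift_le C e (- g (r x, x)) (F x) (F x)"
      unfolding shift_le_def mem_set_plus_iff
      using neg scale_C[OF e_C, of "- g (r x, x)"] by force
    from shift_le_trans[OF le this] have "shift_le C e 0 (F (r x)) (F x)" by simp
    then show False using W_strict[OF xW r[OF x]] neq by (simp add: shift_le_0_iff)
  qed
  have "W retract_of K"
    unfolding retract_of_def retraction_def using cont_r r_W r_id by (auto simp: W_def)
  then have "contractible W"
    using retract_of_contractible starlike_imp_contractible \<open>starlike K\<close> by blast
  moreover have "W \<noteq> {}" using r_W \<open>K \<noteq> {}\<close> by blast
  ultimately show ?thesis unfolding nonempty_contractible_def WW EW by blast
qed

end

section \<open>Pointed cones, including the trivial space\<close>

theorem theorem3p1:
  fixes C :: "'b::banach set"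
    and K :: "'a::real_normed_vector set"
    and F :: "'a \<Rightarrow> 'b set"
  assumes "convex C" and "closed C" and "pointed_cone C" and "interior C \<noteq> {}"
    and "K \<noteq> {}" and "compact K" and "starlike K"
    and "cone_continuous_on C K F"
    and "strictly_quasi_l_convexlike_on C K F"
    and "\<And>x. x \<in> K \<Longrightarrow> F x \<noteq> {} \<and> cone_compact C (F x)"
  shows "nonempty_contractible (W_l C F K) \<and> nonempty_contractible (E_l C F K)"
proof -
  have cone: "cone C" and pointed: "C \<inter> uminus ` C = {0}"
    using assms(3) unfolding pointed_cone_def by auto
  obtain e where e: "e \<in> interior C" using assms(4) by blast
  show ?thesis
  proof (cases "- e \<in> C")
    case False
    then interpret solid_cone C e using assms cone e by unfold_locales auto
    show ?thesis using nonempty_contractible_solutions assms by blast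
  next
    \<comment> \<open>A pointed cone contains \<open>- e\<close> only if \<open>e = 0\<close>, and \<open>0\<close> is interior only if \<open>'b\<close> is trivial.\<close>
    case True
    have "e \<in> C \<inter> uminus ` C"
      using True e interior_subset[of C] by (auto simp: image_iff intro!: bexI[of _ "- e"])
    then have "0 \<in> interior C" using pointed e by simp
    then obtain \<delta> where \<delta>: "\<delta> > 0" "ball 0 \<delta> \<subseteq> C" by (auto simp: mem_interior)
    have zero: "y = 0" for y :: 'b
    proof (rule ccontr)
      assume "y \<noteq> 0"
      \<comment> \<open>Scaled to norm \<open>\<delta> / 2\<close>, so that both \<open>v\<close>
        and \<open>- v\<close> lie in the ball inside \<open>C\<close>.\<close>
      define v where "v = (\<delta> / (2 * norm y)) *\<^sub>R y"
      have "v \<in> C" "- v \<in> C"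
        using \<delta> \<open>y \<noteq> 0\<close> by (auto simp: v_def intro!: subsetD[OF \<delta>(2)])
      then have "v \<in> C \<inter> uminus ` C" by (auto simp: image_iff intro!: bexI[of _ "- v"])
      then show False using pointed \<delta>(1) \<open>y \<noteq> 0\<close> by (auto simp: v_def)
    qed
    have sets: "A = UNIV" if "A \<noteq> {}" for A :: "'b set"
      using that zero by (metis UNIV_eq_I all_not_in_conv)
    have "F x = UNIV" if "x \<in> K" for x using assms(10)[OF that] sets by blast
    \<comment> \<open>All values of \<open>F\<close> on \<open>K\<close> coincide, so each defining
      implication has identical premise and conclusion.\<close>
    then have "W_l C F K = K" "E_l C F K = K"
      unfolding W_l_def E_l_def set_ll_l_def set_le_l_def by auto
    then show ?thesis
      unfolding nonempty_contractible_def using assms(5,7) starlike_imp_contractible by auto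
  qed
qed

end
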